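(* Let $1\le p<\infty$, $1/p+1/q=1$, let $\{\beta(n)\}_{n\ge 0}$ and $\{\delta_n\}_{n\ge0}$ be sequences of positive numbers with $\beta(0)=1$ and $\delta_0=1$, let $d,m_0\in\mathbb{N}_0$, $\alpha_0,\dots,\alpha_d\in\mathbb{R}$, $u(z)=z^{m_0}$ and $\varphi(z)=\sum_{m=0}^{d}\alpha_m z^m$. For $n,L\in\mathbb{N}_0$ put $$\theta_{n,L}:=\sum_{(l_0,\dots,l_d)\in N(n,L)}\frac{L!\,\alpha_0^{l_0}\alpha_1^{l_1}\cdots\alpha_d^{l_d}}{l_0!\cdots l_d!},$$ where $N(n,L):=\{(l_0,\dots,l_d): l_i\in\mathbb{N}_0,\ \sum_{i=0}^{d}l_i=L,\ \sum_{i=1}^{d} i\,l_i=n\}$. (a) If $$\alpha:=\sum_{n=m_0}^{\infty}\left(\frac{\delta_n\beta(n)}{\delta_{m_0}\delta_{n-m_0}}\right)^p\left(\sum_{L\in\mathbb{N}_0}\left(\frac{|\theta_{n-m_0,L}|}{\beta(L)}\right)^q\right)^{p/q}<\infty,$$ then $u\diamond C_\varphi$ is a bounded operator on $\ell^p(\beta)$. (b) If $u\diamond C_\varphi$ is a bounded operator on $\ell^p(\beta)$, then $$M:=\sup_{l\ge0}\frac{\left[\sum_{n=m_0}^{\infty}\left(\frac{\delta_n|\theta_{n-m_0,l}|\beta(n)}{\delta_{m_0}\delta_{n-m_0}}\right)^p\right]^{1/p}}{\beta(l)}<\infty,$$ with $M\le\|u\diamond C_\varphi\|$.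
   Context: $\mathbb{N}_0=\{0,1,2,\dots\}$; $0^0=1$. $\ell^{p}(\beta)$ is the space of formal power series $f(z)=\sum_{n\ge 0}\hat f(n)z^{n}$ with complex coefficients such that $\|f\|_\beta^p=\sum_{n\ge 0}|\hat f(n)|^p\beta(n)^p<\infty$, with norm $\|\cdot\|_\beta$. The weighted Cauchy product of formal power series is $(f\diamond g)(z)=\sum_{n\ge0}\sum_{k\ge0}\frac{\delta_{n+k}}{\delta_n\delta_k}\hat f(n)\hat g(k)z^{n+k}$. The $\diamond$-substitution operator is $(u\diamond C_\varphi)(f)=u\diamond(f\circ\varphi)$, where for a polynomial $\varphi$, $f\circ\varphi=\sum_{L\ge0}\hat f(L)\varphi^L$ is the formal power series whose $n$-th coefficient is $\sum_{L\ge 0}\hat f(L)c_{n,L}$, with $c_{n,L}$ the coefficient of $z^n$ in $\varphi(z)^L$ (these series are required to converge). The operator is bounded on $\ell^p(\beta)$ if it is defined on all of $\ell^p(\beta)$, maps it into itself and is bounded for $\|\cdot\|_\beta$; $\|u\diamond C_\varphi\|$ is the operator norm. If $p=1$ then $q=\infty$, and $(\sum_L(x_L)^q)^{p/q}$ means $(\sup_L x_L)^p$. Standing assumption: if $\lim_n\beta(n+1)/\beta(n)=1$ or $\liminf_n\beta(n)^{1/n}=1$, then $\varphi(\mathbb{D})\subseteq\mathbb{D}$, where $\mathbb{D}$ is the open unit disc of $\mathbb{C}$. *)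

theory Defs
  imports
    "HOL-Analysis.Analysis"
    "HOL-Computational_Algebra.Polynomial"
    "HOL-Computational_Algebra.Formal_Power_Series"
begin

section \<open>The weighted sequence space of formal power series\<close>

definition lp_space :: "real \<Rightarrow> (nat \<Rightarrow> real) \<Rightarrow> complex fps set" where
  "lp_space p \<beta> = {f. summable (\<lambda>n. cmod (fps_nth f n) powr p * \<beta> n powr p)}"

text \<open>Only meaningful on \<open>lp_space p \<beta>\<close>, since \<open>suminf\<close> is unspecified on divergent series.\<close>

definition lp_norm :: "real \<Rightarrow> (nat \<Rightarrow> real) \<Rightarrow> complex fps \<Rightarrow> real" where
  "lp_norm p \<beta> f = (\<Sum>n. cmod (fps_nth f n) powr p * \<beta> n powr p) powr (1 / p)"

section \<open>Weighted Cauchy product and substitution operator\<close>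

definition wcauchy :: "(nat \<Rightarrow> real) \<Rightarrow> complex fps \<Rightarrow> complex fps \<Rightarrow> complex fps" where
  "wcauchy \<delta> f g =
     Abs_fps (\<lambda>m. \<Sum>(n, k) \<in> {(n, k). n + k = m}.
       of_real (\<delta> (n + k) / (\<delta> n * \<delta> k)) * fps_nth f n * fps_nth g k)"

text \<open>
  The library's \<open>fps_compose\<close> truncates the sum over \<open>L\<close> and is the intended composition only if
  \<open>\<phi>\<close> has zero constant term. Here \<open>\<phi>\<close> is an arbitrary polynomial, so every coefficient of
  \<open>f \<circ> \<phi>\<close> is an infinite series, whose convergence is a separate predicate.
\<close>

definition subst_defined :: "complex fps \<Rightarrow> complex poly \<Rightarrow> bool" where
  "subst_defined f \<phi> \<longleftrightarrow> (\<forall>n. summable (\<lambda>L. fps_nth f L * coeff (\<phi> ^ L) n))"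

definition subst_poly :: "complex fps \<Rightarrow> complex poly \<Rightarrow> complex fps" where
  "subst_poly f \<phi> = Abs_fps (\<lambda>n. \<Sum>L. fps_nth f L * coeff (\<phi> ^ L) n)"

definition subst_op ::
  "(nat \<Rightarrow> real) \<Rightarrow> complex fps \<Rightarrow> complex poly \<Rightarrow> complex fps \<Rightarrow> complex fps" where
  "subst_op \<delta> u \<phi> f = wcauchy \<delta> u (subst_poly f \<phi>)"

definition bounded_subst_op ::
  "real \<Rightarrow> (nat \<Rightarrow> real) \<Rightarrow> (nat \<Rightarrow> real) \<Rightarrow> complex fps \<Rightarrow> complex poly \<Rightarrow> bool" where
  "bounded_subst_op p \<beta> \<delta> u \<phi> \<longleftrightarrow>
     (\<forall>f \<in> lp_space p \<beta>. subst_defined f \<phi>) \<and>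
     (\<forall>f \<in> lp_space p \<beta>. subst_op \<delta> u \<phi> f \<in> lp_space p \<beta>) \<and>
     (\<exists>C. \<forall>f \<in> lp_space p \<beta>. lp_norm p \<beta> (subst_op \<delta> u \<phi> f) \<le> C * lp_norm p \<beta> f)"

text \<open>Only meaningful if \<open>bounded_subst_op p \<beta> \<delta> u \<phi>\<close> holds.\<close>

definition subst_op_norm ::
  "real \<Rightarrow> (nat \<Rightarrow> real) \<Rightarrow> (nat \<Rightarrow> real) \<Rightarrow> complex fps \<Rightarrow> complex poly \<Rightarrow> real" where
  "subst_op_norm p \<beta> \<delta> u \<phi> =
     Sup {lp_norm p \<beta> (subst_op \<delta> u \<phi> f) |f. f \<in> lp_space p \<beta> \<and> lp_norm p \<beta> f \<le> 1}"

section \<open>Multinomial coefficients\<close>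

text \<open>A multi-index \<open>(l\<^sub>0, \<dots>, l\<^sub>d)\<close> is a list of length \<open>d + 1\<close>.\<close>

definition multi_indices :: "nat \<Rightarrow> nat \<Rightarrow> nat \<Rightarrow> nat list set" where
  "multi_indices d n L =
     {l. length l = d + 1 \<and> (\<Sum>i=0..d. l ! i) = L \<and> (\<Sum>i=1..d. i * l ! i) = n}"

lemma finite_multi_indices: "finite (multi_indices d n L)"
proof (rule finite_subset)
  show "multi_indices d n L \<subseteq> {l. set l \<subseteq> {..L} \<and> length l = d + 1}"
  proof
    fix l assume l: "l \<in> multi_indices d n L"
    have "l ! i \<le> L" if "i < length l" for i
    proof -
      have "l ! i \<le> (\<Sum>i=0..d. l ! i)"
        by (rule member_le_sum) (use that l in \<open>auto simp: multi_indices_def\<close>)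
      then show ?thesis using l by (simp add: multi_indices_def)
    qed
    then show "l \<in> {l. set l \<subseteq> {..L} \<and> length l = d + 1}"
      using l by (auto simp: multi_indices_def in_set_conv_nth)
  qed
  show "finite {l. set l \<subseteq> {..L} \<and> length l = d + 1}"
    by (rule finite_lists_length_eq) simp
qed

definition theta :: "nat \<Rightarrow> (nat \<Rightarrow> real) \<Rightarrow> nat \<Rightarrow> nat \<Rightarrow> real" where
  "theta d \<alpha> n L =
     (\<Sum>l \<in> multi_indices d n L.
        fact L * (\<Prod>i=0..d. \<alpha> i ^ (l ! i)) / (\<Prod>i=0..d. fact (l ! i)))"

section \<open>Extended nonnegative quantities\<close>

text \<open>Powers with positive exponent, where \<open>\<infinity>\<close> to the power \<open>r\<close> is \<open>\<infinity>\<close>.\<close>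

definition ennreal_powr :: "ennreal \<Rightarrow> real \<Rightarrow> ennreal" where
  "ennreal_powr x r = (if x = \<infinity> then \<infinity> else ennreal (enn2real x powr r))"

text \<open>
  The quantity \<open>(\<Sum>\<^sub>L x\<^sub>L\<^sup>q)\<close> to the power \<open>p / q\<close>, read as \<open>(sup\<^sub>L x\<^sub>L)\<^sup>p\<close> when \<open>q = \<infinity>\<close>.
\<close>

definition lq_sum_powr :: "real \<Rightarrow> ennreal \<Rightarrow> (nat \<Rightarrow> real) \<Rightarrow> ennreal" where
  "lq_sum_powr p q x =
     (if q = \<infinity> then ennreal_powr (SUP L. ennreal (x L)) p
      else ennreal_powr (\<Sum>L. ennreal (x L powr enn2real q)) (p / enn2real q))"

end

theory Submission
  imports Defs
begin

text \<open>
  Let \<open>c\<^sub>k\<^sub>,\<^sub>L\<close> be the coefficient of \<open>z\<^sup>k\<close> in \<open>\<phi>\<^sup>L\<close>. By the multinomial theorem it equals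
  \<open>\<theta>\<^sub>k\<^sub>,\<^sub>L\<close> (\<open>coeff_power_eq_theta\<close>). Multiplying by \<open>z\<^sup>m\<close> only shifts and rescales, so the operator is
  given by an infinite matrix: its coefficient at \<open>z\<^sup>m\<^sup>+\<^sup>k\<close> is
  \<open>\<delta>\<^sub>m\<^sub>+\<^sub>k / (\<delta>\<^sub>m \<delta>\<^sub>k)\<close> times \<open>\<Sum>\<^sub>L f\<^sub>L c\<^sub>k\<^sub>,\<^sub>L\<close>, and the coefficients below \<open>z\<^sup>m\<close> vanish. The two parts of
  the theorem estimate this matrix by its rows and by its columns.

  For the sufficient condition, write each term of a row as
  \<open>(f\<^sub>L \<beta>\<^sub>L) (c\<^sub>k\<^sub>,\<^sub>L / \<beta>\<^sub>L)\<close>. Hoelder's inequality (\<open>lq_sum_powr_pairing\<close>, which treats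
  \<open>q = \<infinity>\<close> alongside finite \<open>q\<close>) gives absolute convergence of the row and bounds the \<open>p\<close>-th power of
  its value by \<open>\<parallel>f\<parallel>\<^sup>p\<close> times the \<open>p\<close>-th power of the \<open>q\<close>-norm of the weighted row. Summing over the
  rows bounds the \<open>p\<close>-th power of the norm of the image by \<open>A \<parallel>f\<parallel>\<^sup>p\<close>
  (\<open>bounded_subst_op_if_rows\<close>).

  For the necessary condition, apply the operator to the unit vector \<open>z\<^sup>l / \<beta>\<^sub>l\<close>. Its image is the
  \<open>l\<close>-th column divided by \<open>\<beta>\<^sub>l\<close>, so the \<open>l\<close>-th term of the supremum \<open>M\<close> is exactly the norm of this
  image and lies below the operator norm (\<open>subst_op_norm_ge_column\<close>).
\<close>

section \<open>Coefficients of the powers of a polynomial\<close>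

text \<open>
  The multinomial theorem is proved by induction on \<open>d\<close>, splitting off the highest monomial; on
  multi-indices this means splitting off the last entry.
\<close>

lemma snoc_in_multi_indices_iff:
  "l @ [j] \<in> multi_indices (Suc d) n L \<longleftrightarrow>
     j \<le> L \<and> j * Suc d \<le> n \<and> l \<in> multi_indices d (n - j * Suc d) (L - j)"
proof (cases "length l = Suc d")
  case True
  have "(\<Sum>i=0..d. (l @ [j]) ! i) = (\<Sum>i=0..d. l ! i)"
    using True by (intro sum.cong) (auto simp: nth_append)
  moreover have "(\<Sum>i=1..d. i * (l @ [j]) ! i) = (\<Sum>i=1..d. i * l ! i)"
    using True by (intro sum.cong) (auto simp: nth_append)
  moreover have "(l @ [j]) ! Suc d = j"
    using True by (simp add: nth_append)
  ultimately show ?thesis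
    using True by (auto simp: multi_indices_def algebra_simps)
qed (auto simp: multi_indices_def)

text \<open>
  This mirrors the binomial expansion of \<open>(a + b)\<^sup>L\<close> with \<open>a\<close> the highest monomial: choosing it \<open>j\<close>
  times leaves the degree \<open>n - j (d + 1)\<close> for the other \<open>L - j\<close> factors, hence the case distinction.
\<close>

lemma theta_Suc:
  "theta (Suc d) \<alpha> n L =
     (\<Sum>j\<le>L. if j * Suc d \<le> n
            then of_nat (L choose j) * \<alpha> (Suc d) ^ j * theta d \<alpha> (n - j * Suc d) (L - j)
            else 0)"
proof -
  define t where "t d L l = fact L * (\<Prod>i=0..d. \<alpha> i ^ (l ! i)) / (\<Prod>i=0..d. fact (l ! i))"
    for d L and l :: "nat list"
  let ?J = "{j \<in> {..L}. j * Suc d \<le> n}"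
  let ?I = "\<lambda>j. multi_indices d (n - j * Suc d) (L - j)"
  have t_snoc: "t (Suc d) L (l @ [j]) = of_nat (L choose j) * \<alpha> (Suc d) ^ j * t d (L - j) l"
    if "j \<le> L" "length l = Suc d" for j l
  proof -
    have "(\<Prod>i=0..d. \<alpha> i ^ ((l @ [j]) ! i)) = (\<Prod>i=0..d. \<alpha> i ^ (l ! i))"
      using that by (intro prod.cong) (auto simp: nth_append)
    moreover have "(\<Prod>i=0..d. fact ((l @ [j]) ! i)) = (\<Prod>i=0..d. fact (l ! i) :: real)"
      using that by (intro prod.cong) (auto simp: nth_append)
    moreover have "(l @ [j]) ! Suc d = j"
      using that by (simp add: nth_append)
    ultimately show ?thesis
      using that by (simp add: t_def binomial_fact field_simps)
  qed
  have "theta (Suc d) \<alpha> n L = (\<Sum>l\<in>multi_indices (Suc d) n L. t (Suc d) L l)"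
    by (simp add: theta_def t_def)
  also have "\<dots> = (\<Sum>(j, l)\<in>Sigma ?J ?I. t (Suc d) L (l @ [j]))"
  proof (rule sum.reindex_bij_witness[where i = "\<lambda>(j, l). l @ [j]"
        and j = "\<lambda>l. (last l, butlast l)"])
    fix l assume l: "l \<in> multi_indices (Suc d) n L"
    then have "l \<noteq> []" by (auto simp: multi_indices_def)
    then have eq: "butlast l @ [last l] = l" by simp
    then show "(case (last l, butlast l) of (j, l) \<Rightarrow> l @ [j]) = l" by simp
    show "(last l, butlast l) \<in> Sigma ?J ?I"
      using l snoc_in_multi_indices_iff[of "butlast l" "last l" d n L] by (simp only: eq) auto
    show "(case (last l, butlast l) of (j, l) \<Rightarrow> t (Suc d) L (l @ [j])) = t (Suc d) L l"
      using eq by simp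
  qed (auto simp: snoc_in_multi_indices_iff simp del: mult_Suc_right)
  also have "\<dots> = (\<Sum>j\<in>?J. \<Sum>l\<in>?I j. t (Suc d) L (l @ [j]))"
    by (rule sum.Sigma[symmetric]) (auto simp: finite_multi_indices)
  also have "\<dots> = (\<Sum>j\<in>?J. of_nat (L choose j) * \<alpha> (Suc d) ^ j * theta d \<alpha> (n - j * Suc d) (L - j))"
  proof (rule sum.cong)
    fix j assume "j \<in> ?J"
    then have "(\<Sum>l\<in>?I j. t (Suc d) L (l @ [j])) =
        (\<Sum>l\<in>?I j. of_nat (L choose j) * \<alpha> (Suc d) ^ j * t d (L - j) l)"
      by (intro sum.cong refl t_snoc) (auto simp: multi_indices_def)
    also have "\<dots> = of_nat (L choose j) * \<alpha> (Suc d) ^ j * theta d \<alpha> (n - j * Suc d) (L - j)"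
      by (simp only: theta_def t_def sum_distrib_left)
    finally show "(\<Sum>l\<in>?I j. t (Suc d) L (l @ [j])) = \<dots>" .
  qed simp
  also have "\<dots> = (\<Sum>j\<le>L. if j * Suc d \<le> n
            then of_nat (L choose j) * \<alpha> (Suc d) ^ j * theta d \<alpha> (n - j * Suc d) (L - j)
            else 0)"
    by (rule sum.inter_filter) simp
  finally show ?thesis .
qed

lemma coeff_power_eq_theta:
  "coeff ((\<Sum>m=0..d. monom (of_real (\<alpha> m)) m) ^ L) n = (of_real (theta d \<alpha> n L) :: complex)"
proof (induction d arbitrary: n L)
  case 0
  have "multi_indices 0 n L = (if n = 0 then {[L]} else {})"
    by (auto simp: multi_indices_def length_Suc_conv)
  then show ?case
    by (simp add: theta_def monom_power)
next
  case (Suc d)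
  let ?a = "monom (of_real (\<alpha> (Suc d))) (Suc d) :: complex poly"
  let ?b = "\<Sum>m=0..d. monom (of_real (\<alpha> m)) m :: complex poly"
  have "coeff ((\<Sum>m=0..Suc d. monom (of_real (\<alpha> m)) m) ^ L) n = coeff ((?a + ?b) ^ L) n"
    by (simp add: add.commute)
  also have "\<dots> = (\<Sum>j\<le>L. of_nat (L choose j) * coeff (?a ^ j * ?b ^ (L - j)) n)"
    by (simp add: binomial_ring coeff_sum mult.assoc of_nat_poly)
  also have "\<dots> = (\<Sum>j\<le>L. of_real (if j * Suc d \<le> n
            then of_nat (L choose j) * \<alpha> (Suc d) ^ j * theta d \<alpha> (n - j * Suc d) (L - j)
            else 0))"
    by (intro sum.cong)
      (auto simp: monom_power coeff_monom_mult Suc.IH mult.commute[of _ "Suc d"] not_less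
        simp del: mult_Suc_right mult_Suc)
  also have "\<dots> = of_real (theta (Suc d) \<alpha> n L)"
    by (simp only: theta_Suc of_real_sum)
  finally show ?case .
qed

section \<open>Hoelder's inequality for series\<close>

text \<open>
  Young's inequality, applied to the sequences normalised to have \<open>p\<close>-norm and \<open>q\<close>-norm \<open>1\<close>, yields
  a convergent majorant whose sum is the product of the two norms.
\<close>

lemma holder_series:
  fixes x y :: "nat \<Rightarrow> real"
  assumes pq: "1 < p" "1 < q" "1 / p + 1 / q = 1"
    and nonneg: "\<And>n. 0 \<le> x n" "\<And>n. 0 \<le> y n"
    and x: "summable (\<lambda>n. x n powr p)" and y: "summable (\<lambda>n. y n powr q)"
  shows "summable (\<lambda>n. x n * y n)"
    and "(\<Sum>n. x n * y n) \<le> (\<Sum>n. x n powr p) powr (1 / p) * (\<Sum>n. y n powr q) powr (1 / q)"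
proof -
  define X where "X = (\<Sum>n. x n powr p)"
  define Y where "Y = (\<Sum>n. y n powr q)"
  have "summable (\<lambda>n. x n * y n) \<and> (\<Sum>n. x n * y n) \<le> X powr (1 / p) * Y powr (1 / q)"
  proof (cases "X = 0 \<or> Y = 0")
    case True
    then have "(\<forall>n. x n = 0) \<or> (\<forall>n. y n = 0)"
      using suminf_eq_zero_iff[OF x] suminf_eq_zero_iff[OF y] by (auto simp: X_def Y_def)
    then have "(\<lambda>n. x n * y n) = (\<lambda>n. 0)" by auto
    then show ?thesis by simp
  next
    case False
    have "0 \<le> X" "0 \<le> Y"
      unfolding X_def Y_def by (intro suminf_nonneg x y; simp)+
    with False have pos: "0 < X" "0 < Y" by auto
    let ?c = "X powr (1 / p) * Y powr (1 / q)"
    \<comment> \<open>The series in parentheses sums to \<open>1 / p + 1 / q = 1\<close>.\<close>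
    let ?g = "\<lambda>n. ?c * (x n powr p / X / p + y n powr q / Y / q)"
    have young: "x n * y n \<le> ?g n" for n
    proof -
      have "x n / X powr (1 / p) * (y n / Y powr (1 / q)) \<le>
          (x n / X powr (1 / p)) powr p / p + (y n / Y powr (1 / q)) powr q / q"
        using pq nonneg by (intro Youngs_inequality) auto
      also have "\<dots> = x n powr p / X / p + y n powr q / Y / q"
        using pq pos nonneg by (simp add: powr_divide powr_powr)
      finally show ?thesis
        using pos by (simp add: field_simps)
    qed
    have "(\<lambda>n. x n powr p / X / p + y n powr q / Y / q) sums (X / X / p + Y / Y / q)"
      unfolding X_def Y_def by (intro sums_add sums_divide summable_sums x y)
    then have "(\<lambda>n. x n powr p / X / p + y n powr q / Y / q) sums 1"
      using pos pq by simp
    then have g: "?g sums ?c"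
      using sums_mult[of _ 1 ?c] by simp
    have s: "summable (\<lambda>n. x n * y n)"
      using young nonneg by (intro summable_comparison_test'[OF sums_summable[OF g], of 0]) simp
    moreover have "(\<Sum>n. x n * y n) \<le> ?c"
      using suminf_le[OF young s sums_summable[OF g]] sums_unique[OF g] by simp
    ultimately show ?thesis by simp
  qed
  then show "summable (\<lambda>n. x n * y n)"
    and "(\<Sum>n. x n * y n) \<le> (\<Sum>n. x n powr p) powr (1 / p) * (\<Sum>n. y n powr q) powr (1 / q)"
    by (simp_all add: X_def Y_def)
qed

text \<open>
  The conjugate exponent of \<open>p\<close> lives in the extended nonnegative reals, where \<open>1 / \<infinity> = 0\<close>: it is
  infinite exactly for \<open>p = 1\<close>, and otherwise it is a real conjugate exponent in the usual sense.
\<close>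

lemma conjugate_exponent_cases:
  assumes p: "1 \<le> p" and q: "1 / ennreal p + 1 / q = 1"
  obtains "p = 1" "q = \<infinity>"
  | r where "1 < p" "1 < r" "1 / p + 1 / r = 1" "q = ennreal r"
proof (cases "p = 1")
  case True
  have "1 + 1 / q = 1 + 0" using q True by simp
  then have "1 / q = 0" by (subst (asm) ennreal_add_left_cancel) auto
  then have "q = \<infinity>" by (simp add: divide_ennreal_def)
  with True show ?thesis by (rule that(1))
next
  case False
  with p have p1: "1 < p" by simp
  have inv_p: "1 / ennreal p = ennreal (1 / p)"
    using divide_ennreal[of 1 p] p1 by simp
  have "q \<noteq> 0"
  proof
    assume "q = 0"
    then show False using q by (simp add: ennreal_divide_zero)
  qed
  moreover have "q \<noteq> \<infinity>"
  proof
    assume "q = \<infinity>"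
    then have "ennreal (1 / p) = 1" using q by (simp add: inv_p)
    then show False using p1 by simp
  qed
  ultimately obtain r where r: "q = ennreal r" "0 < r"
    by (cases q) (auto simp: ennreal_eq_0_iff not_le)
  have inv_q: "1 / q = ennreal (1 / r)"
    using divide_ennreal[of 1 r] r by simp
  have "ennreal (1 / p + 1 / r) = ennreal (1 / p) + ennreal (1 / r)"
    using p1 r by (intro ennreal_plus) auto
  also have "\<dots> = 1"
    using q by (simp only: inv_p inv_q)
  finally have pr: "1 / p + 1 / r = 1"
    by (simp only: ennreal_eq_1)
  have "1 / r < 1" using pr p1 zero_less_divide_1_iff[of p] by linarith
  then have "1 < r" using r by simp
  with p1 pr r show ?thesis by (intro that(2))
qed

lemma ennreal_powr_1: "ennreal_powr x 1 = x"
  by (cases x) (simp_all add: ennreal_powr_def)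

lemma lq_sum_powr_pairing_sup:
  fixes x y :: "nat \<Rightarrow> real"
  assumes nonneg: "\<And>n. 0 \<le> x n" "\<And>n. 0 \<le> y n"
    and x: "summable x" and y: "lq_sum_powr 1 \<infinity> y < \<infinity>"
  shows "summable (\<lambda>n. x n * y n) \<and>
    (\<Sum>n. x n * y n) \<le> (\<Sum>n. x n) * enn2real (lq_sum_powr 1 \<infinity> y)"
proof -
  define S where "S = enn2real (lq_sum_powr 1 \<infinity> y)"
  have lq: "lq_sum_powr 1 \<infinity> y = (SUP n. ennreal (y n))"
    unfolding lq_sum_powr_def if_P[OF refl] by (rule ennreal_powr_1)
  have S: "(SUP n. ennreal (y n)) = ennreal S"
    unfolding S_def lq[symmetric] using y by (simp only: ennreal_enn2real infinity_ennreal_def)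
  have yS: "y n \<le> S" for n
  proof -
    have "ennreal (y n) \<le> ennreal S" unfolding S[symmetric] by (rule SUP_upper) simp
    then show ?thesis by (simp add: ennreal_le_iff S_def)
  qed
  have le: "x n * y n \<le> x n * S" for n using yS nonneg by (intro mult_left_mono) auto
  have s: "summable (\<lambda>n. x n * y n)"
    using le nonneg by (intro summable_comparison_test'[OF summable_mult2[OF x, of S], of 0]) simp
  moreover have "(\<Sum>n. x n * y n) \<le> (\<Sum>n. x n) * S"
    using suminf_le[OF le s summable_mult2[OF x]] suminf_mult2[OF x] by simp
  ultimately show ?thesis by (simp only: S_def)
qed

lemma lq_sum_powr_pairing_finite:
  fixes x y :: "nat \<Rightarrow> real"
  assumes pr: "1 < p" "1 < r" "1 / p + 1 / r = 1"
    and nonneg: "\<And>n. 0 \<le> x n" "\<And>n. 0 \<le> y n"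
    and x: "summable (\<lambda>n. x n powr p)" and y: "lq_sum_powr p (ennreal r) y < \<infinity>"
  shows "summable (\<lambda>n. x n * y n) \<and>
    (\<Sum>n. x n * y n) powr p \<le> (\<Sum>n. x n powr p) * enn2real (lq_sum_powr p (ennreal r) y)"
proof -
  have lq: "lq_sum_powr p (ennreal r) y = ennreal_powr (\<Sum>n. ennreal (y n powr r)) (p / r)"
    using pr by (simp add: lq_sum_powr_def)
  have "(\<Sum>n. ennreal (y n powr r)) \<noteq> top"
    using y unfolding lq ennreal_powr_def by auto
  then have sy: "summable (\<lambda>n. y n powr r)"
    by (rule summable_suminf_not_top[rotated]) simp
  then have "(\<Sum>n. ennreal (y n powr r)) = ennreal (\<Sum>n. y n powr r)"
    by (intro suminf_ennreal2) auto
  moreover have Y0: "0 \<le> (\<Sum>n. y n powr r)" by (intro suminf_nonneg sy) simp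
  ultimately have lq_real: "enn2real (lq_sum_powr p (ennreal r) y) = (\<Sum>n. y n powr r) powr (p / r)"
    by (simp add: lq ennreal_powr_def)
  have X0: "0 \<le> (\<Sum>n. x n powr p)" by (intro suminf_nonneg x) simp
  note H = holder_series[of p r x y, OF pr nonneg x sy]
  have "(\<Sum>n. x n * y n) powr p \<le>
      ((\<Sum>n. x n powr p) powr (1 / p) * (\<Sum>n. y n powr r) powr (1 / r)) powr p"
    using pr nonneg by (intro powr_mono2 suminf_nonneg H) auto
  also have "\<dots> = (\<Sum>n. x n powr p) * (\<Sum>n. y n powr r) powr (p / r)"
    using X0 Y0 pr(1) by (simp add: powr_mult powr_powr)
  finally show ?thesis using H(1) by (simp only: lq_real)
qed

text \<open>
  Both readings of the mixed quantity are \<open>p\<close>-th powers of the norm dual to the \<open>p\<close>-norm, so a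
  row of the matrix is estimated in the same way for all \<open>p\<close>.
\<close>

lemma lq_sum_powr_pairing:
  fixes x y :: "nat \<Rightarrow> real"
  assumes p: "1 \<le> p" and q: "1 / ennreal p + 1 / q = 1"
    and nonneg: "\<And>n. 0 \<le> x n" "\<And>n. 0 \<le> y n"
    and x: "summable (\<lambda>n. x n powr p)" and y: "lq_sum_powr p q y < \<infinity>"
  shows "summable (\<lambda>n. x n * y n)"
    and "(\<Sum>n. x n * y n) powr p \<le> (\<Sum>n. x n powr p) * enn2real (lq_sum_powr p q y)"
proof -
  have "summable (\<lambda>n. x n * y n) \<and>
    (\<Sum>n. x n * y n) powr p \<le> (\<Sum>n. x n powr p) * enn2real (lq_sum_powr p q y)"
    using p q
  proof (cases rule: conjugate_exponent_cases)
    case 1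
    have powr1: "(\<lambda>n. x n powr p) = x" using 1 nonneg by simp
    have H: "summable (\<lambda>n. x n * y n) \<and> (\<Sum>n. x n * y n) \<le> suminf x * enn2real (lq_sum_powr p q y)"
      using lq_sum_powr_pairing_sup[of x y, OF nonneg] x y unfolding powr1 unfolding 1 by blast
    moreover have "0 \<le> (\<Sum>n. x n * y n)"
      using nonneg H by (intro suminf_nonneg) auto
    then have "(\<Sum>n. x n * y n) powr p = (\<Sum>n. x n * y n)"
      by (simp only: 1 powr_one)
    ultimately show ?thesis by (simp only: powr1)
  next
    case (2 r)
    then show ?thesis
      using lq_sum_powr_pairing_finite[of p r x y, OF 2(1-3) nonneg x] y by blast
  qed
  then show "summable (\<lambda>n. x n * y n)"
    and "(\<Sum>n. x n * y n) powr p \<le> (\<Sum>n. x n powr p) * enn2real (lq_sum_powr p q y)"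
    by blast+
qed

section \<open>The matrix of the substitution operator\<close>

lemma subst_op_X_power_nth:
  "fps_nth (subst_op \<delta> (fps_X ^ m) \<phi> f) n =
     (if n < m then 0
      else of_real (\<delta> n / (\<delta> m * \<delta> (n - m))) * (\<Sum>L. fps_nth f L * coeff (\<phi> ^ L) (n - m)))"
proof -
  let ?g = "subst_poly f \<phi>"
  have eq: "{(i, k). i + k = n} = (\<lambda>i. (i, n - i)) ` {..n}" by auto
  have "fps_nth (subst_op \<delta> (fps_X ^ m) \<phi> f) n =
      (\<Sum>i\<le>n. of_real (\<delta> n / (\<delta> i * \<delta> (n - i))) * fps_nth (fps_X ^ m) i * fps_nth ?g (n - i))"
    unfolding subst_op_def wcauchy_def fps_nth_Abs_fps eq
    by (subst sum.reindex) (auto simp: inj_on_def)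
  also have "\<dots> = (\<Sum>i\<le>n. if i = m then
      of_real (\<delta> n / (\<delta> m * \<delta> (n - m))) * fps_nth ?g (n - m) else 0)"
    by (intro sum.cong) (auto simp: fps_X_power_nth)
  also have "\<dots> = (if n < m then 0 else of_real (\<delta> n / (\<delta> m * \<delta> (n - m))) * fps_nth ?g (n - m))"
    by (auto simp: sum.delta)
  finally show ?thesis by (simp add: subst_poly_def)
qed

text \<open>
  The \<open>n\<close>-th summand of the \<open>p\<close>-th power of the norm of the image at \<open>n = m + k\<close>, with the weights of
  the product and of the space collected in one factor. Both estimates start from this form.
\<close>

lemma subst_op_X_power_weighted_nth:
  assumes "\<And>n. 0 < \<delta> n"
  shows "cmod (fps_nth (subst_op \<delta> (fps_X ^ m) \<phi> f) (m + k)) powr p * \<beta> (m + k) powr p =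
     (\<delta> (m + k) * \<beta> (m + k) / (\<delta> m * \<delta> k)) powr p *
       cmod (\<Sum>L. fps_nth f L * coeff (\<phi> ^ L) k) powr p"
proof -
  let ?h = "cmod (\<Sum>L. fps_nth f L * coeff (\<phi> ^ L) k)"
  let ?r = "\<delta> (m + k) / (\<delta> m * \<delta> k)"
  have r: "0 < ?r" using assms by simp
  have "cmod (fps_nth (subst_op \<delta> (fps_X ^ m) \<phi> f) (m + k)) = ?r * ?h"
    using r by (simp add: subst_op_X_power_nth norm_mult norm_of_real abs_of_pos
        del: of_real_divide of_real_mult abs_divide abs_mult)
  moreover have "(?r * ?h) powr p * \<beta> (m + k) powr p =
      (\<delta> (m + k) * \<beta> (m + k) / (\<delta> m * \<delta> k)) powr p * ?h powr p"
    by (simp add: powr_mult powr_divide)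
  ultimately show ?thesis by (simp only:)
qed

text \<open>
  The image has no coefficients below \<open>z\<^sup>m\<close>; the next two facts move sums over all indices, or over
  the indices from \<open>m\<close> on, to sums over the rows \<open>k = n - m\<close>.
\<close>

lemma infsum_atLeast_ennreal:
  fixes f :: "nat \<Rightarrow> ennreal"
  shows "(\<Sum>\<^sub>\<infinity>n\<in>{m..}. f n) = (\<Sum>k. f (m + k))"
proof -
  have "(\<Sum>\<^sub>\<infinity>n\<in>{m..}. f n) = (\<Sum>\<^sub>\<infinity>k. f (m + k))"
    by (rule infsum_reindex_bij_witness[where i = "\<lambda>k. m + k" and j = "\<lambda>n. n - m"]) auto
  also have "\<dots> = (\<Sum>k. f (m + k))"
    by (intro sums_unique has_sum_imp_sums has_sum_infsum nonneg_summable_on_complete) simp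
  finally show ?thesis .
qed

lemma sums_shift_iff:
  fixes g :: "nat \<Rightarrow> real"
  assumes "\<And>n. n < m \<Longrightarrow> g n = 0"
  shows "g sums s \<longleftrightarrow> (\<lambda>k. g (m + k)) sums s"
  using sums_zero_iff_shift[of m g s] assms by (simp add: add.commute)

section \<open>Estimates by rows and by columns\<close>

text \<open>
  Here \<open>F = \<parallel>f\<parallel>\<^sup>p\<close>, and \<open>a k\<close> is the contribution of the \<open>k\<close>-th row to the sum assumed finite. That sum
  controls each single row because the weights in front of the rows are positive; this gives the
  convergence of \<open>f \<circ> \<phi>\<close> coefficient by coefficient.
\<close>

lemma bounded_subst_op_if_rows:
  assumes p: "1 \<le> p" and q: "1 / ennreal p + 1 / q = 1"
    and \<beta>_pos: "\<And>n. 0 < \<beta> n" and \<delta>_pos: "\<And>n. 0 < \<delta> n"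
    and finite:
      "(\<Sum>k. ennreal ((\<delta> (m + k) * \<beta> (m + k) / (\<delta> m * \<delta> k)) powr p) *
        lq_sum_powr p q (\<lambda>L. cmod (coeff (\<phi> ^ L) k) / \<beta> L)) < \<infinity>"
  shows "bounded_subst_op p \<beta> \<delta> (fps_X ^ m) \<phi>"
proof -
  let ?T = "subst_op \<delta> (fps_X ^ m) \<phi>"
  let ?lq = "\<lambda>k. lq_sum_powr p q (\<lambda>L. cmod (coeff (\<phi> ^ L) k) / \<beta> L)"
  define w where "w k = \<delta> (m + k) * \<beta> (m + k) / (\<delta> m * \<delta> k)" for k
  note finite = finite[folded w_def]
  define a where "a k = w k powr p * enn2real (?lq k)" for k
  have w_pos: "0 < w k" for k
    using \<beta>_pos \<delta>_pos by (simp add: w_def)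
  have term_finite: "ennreal (w k powr p) * ?lq k < \<infinity>" for k
    using finite sum_le_suminf[of "\<lambda>k. ennreal (w k powr p) * ?lq k" "{k}"]
    by (simp add: le_less_trans)
  have lq_finite: "?lq k < \<infinity>" for k
    using term_finite[of k] w_pos[of k] by (auto simp: ennreal_mult_less_top)
  have "ennreal (a k) = ennreal (w k powr p) * ?lq k" for k
    using lq_finite[of k] by (simp add: a_def ennreal_mult less_top)
  then have "(\<Sum>k. ennreal (a k)) \<noteq> top"
    using finite by simp
  then have a: "summable a"
    by (rule summable_suminf_not_top[rotated]) (simp add: a_def)
  have *: "subst_defined f \<phi> \<and> ?T f \<in> lp_space p \<beta> \<and>
      lp_norm p \<beta> (?T f) \<le> suminf a powr (1 / p) * lp_norm p \<beta> f"
    if f: "f \<in> lp_space p \<beta>" for f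
  proof -
    define F where "F = (\<Sum>n. cmod (fps_nth f n) powr p * \<beta> n powr p)"
    let ?x = "\<lambda>L. cmod (fps_nth f L) * \<beta> L"
    let ?y = "\<lambda>k L. cmod (coeff (\<phi> ^ L) k) / \<beta> L"
    let ?c = "\<lambda>k L. fps_nth f L * coeff (\<phi> ^ L) k"
    have xp: "(\<lambda>L. ?x L powr p) = (\<lambda>L. cmod (fps_nth f L) powr p * \<beta> L powr p)"
      by (simp only: powr_mult)
    have sx: "summable (\<lambda>L. ?x L powr p)"
      using f by (simp add: xp lp_space_def)
    have xy: "?x L * ?y k L = cmod (?c k L)" for k L
      using \<beta>_pos[of L] by (simp add: norm_mult)
    have pairing: "summable (\<lambda>L. cmod (?c k L))"
      "(\<Sum>L. cmod (?c k L)) powr p \<le> F * enn2real (?lq k)" for k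
    proof -
      have "0 \<le> ?x L" "0 \<le> ?y k L" for L
        using \<beta>_pos[of L] by simp_all
      note pairing = lq_sum_powr_pairing[OF p q this sx lq_finite[of k]]
      show "summable (\<lambda>L. cmod (?c k L))"
        using pairing(1) by (simp only: xy)
      show "(\<Sum>L. cmod (?c k L)) powr p \<le> F * enn2real (?lq k)"
        using pairing(2) by (simp only: xy xp F_def)
    qed
    have def: "subst_defined f \<phi>"
      unfolding subst_defined_def using pairing(1) by (blast intro: summable_norm_cancel)
    define t where "t = (\<lambda>n. cmod (fps_nth (?T f) n) powr p * \<beta> n powr p)"
    have t_le: "t (m + k) \<le> a k * F" for k
    proof -
      have "t (m + k) = w k powr p * cmod (\<Sum>L. ?c k L) powr p"
        using subst_op_X_power_weighted_nth[of \<delta>, OF \<delta>_pos] by (simp only: t_def w_def)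
      also have "\<dots> \<le> w k powr p * (F * enn2real (?lq k))"
        using p summable_norm[OF pairing(1)[of k]]
        by (intro mult_left_mono order_trans[OF powr_mono2 pairing(2)]) auto
      finally show ?thesis by (simp add: a_def mult_ac)
    qed
    have s: "summable (\<lambda>k. t (m + k))"
      using t_le by (intro summable_comparison_test'[OF summable_mult2[OF a, of F], of 0])
        (simp add: t_def)
    have "t n = 0" if "n < m" for n
      using that by (simp add: t_def subst_op_X_power_nth)
    then have t: "t sums (\<Sum>k. t (m + k))"
      using summable_sums[OF s] by (subst sums_shift_iff)
    have "suminf t \<le> suminf a * F"
      using suminf_le[OF t_le s summable_mult2[OF a]] suminf_mult2[OF a] sums_unique[OF t] by simp
    then have "suminf t powr (1 / p) \<le> (suminf a * F) powr (1 / p)"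
      using p by (intro powr_mono2 suminf_nonneg sums_summable[OF t]) (auto simp: t_def)
    then have "lp_norm p \<beta> (?T f) \<le> suminf a powr (1 / p) * lp_norm p \<beta> f"
      by (simp add: lp_norm_def powr_mult F_def t_def)
    then show ?thesis
      using def sums_summable[OF t] by (simp add: lp_space_def t_def)
  qed
  then show ?thesis unfolding bounded_subst_op_def by blast
qed

text \<open>
  The operator norm is a supremum of reals, so this needs the set of values to be bounded above. The
  constant \<open>C\<close> of a bounded operator could be negative, hence the bound \<open>\<bar>C\<bar>\<close>.
\<close>

lemma subst_op_norm_upper:
  assumes "bounded_subst_op p \<beta> \<delta> u \<phi>" and "f \<in> lp_space p \<beta>" "lp_norm p \<beta> f \<le> 1"
  shows "lp_norm p \<beta> (subst_op \<delta> u \<phi> f) \<le> subst_op_norm p \<beta> \<delta> u \<phi>"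
proof -
  obtain C where C: "\<forall>f \<in> lp_space p \<beta>. lp_norm p \<beta> (subst_op \<delta> u \<phi> f) \<le> C * lp_norm p \<beta> f"
    using assms(1) by (auto simp: bounded_subst_op_def)
  have "lp_norm p \<beta> (subst_op \<delta> u \<phi> g) \<le> \<bar>C\<bar>" if "g \<in> lp_space p \<beta>" "lp_norm p \<beta> g \<le> 1" for g
  proof -
    have g0: "0 \<le> lp_norm p \<beta> g" by (simp add: lp_norm_def)
    have "lp_norm p \<beta> (subst_op \<delta> u \<phi> g) \<le> C * lp_norm p \<beta> g" using C that by blast
    also have "\<dots> \<le> \<bar>C\<bar> * lp_norm p \<beta> g" using g0 by (intro mult_right_mono) auto
    also have "\<dots> \<le> \<bar>C\<bar> * 1" using that by (intro mult_left_mono) auto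
    finally show ?thesis by simp
  qed
  then show ?thesis
    unfolding subst_op_norm_def using assms(2,3)
    by (intro cSup_upper bdd_aboveI[where M = "\<bar>C\<bar>"]) auto
qed

text \<open>
  The left-hand side is the norm of the image of the unit vector \<open>z\<^sup>l / \<beta>\<^sub>l\<close>.
\<close>

lemma subst_op_norm_ge_column:
  assumes p: "1 \<le> p" and \<beta>_pos: "\<And>n. 0 < \<beta> n" and \<delta>_pos: "\<And>n. 0 < \<delta> n"
    and bounded: "bounded_subst_op p \<beta> \<delta> (fps_X ^ m) \<phi>"
  shows "ennreal_powr (\<Sum>k. ennreal ((\<delta> (m + k) * cmod (coeff (\<phi> ^ l) k) * \<beta> (m + k) /
            (\<delta> m * \<delta> k)) powr p)) (1 / p) / ennreal (\<beta> l)
    \<le> ennreal (subst_op_norm p \<beta> \<delta> (fps_X ^ m) \<phi>)"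
proof -
  let ?T = "subst_op \<delta> (fps_X ^ m) \<phi>"
  define f :: "complex fps" where "f = fps_const (of_real (1 / \<beta> l)) * fps_X ^ l"
  have f_nth: "fps_nth f n = (if n = l then of_real (1 / \<beta> l) else 0)" for n
    by (simp add: f_def fps_X_power_nth)
  have f_sums: "(\<lambda>n. cmod (fps_nth f n) powr p * \<beta> n powr p) sums 1"
  proof -
    have "(\<lambda>n. cmod (fps_nth f n) powr p * \<beta> n powr p) = (\<lambda>n. if n = l then 1 else 0)"
      using p \<beta>_pos[of l] by (auto simp: f_nth norm_divide powr_divide fun_eq_iff)
    then show ?thesis using sums_single[of l "\<lambda>_. 1 :: real"] by simp
  qed
  then have f: "f \<in> lp_space p \<beta>" and f_norm: "lp_norm p \<beta> f = 1"
    by (auto simp: lp_space_def lp_norm_def sums_iff)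
  define b where "b k = (\<delta> (m + k) * cmod (coeff (\<phi> ^ l) k) * \<beta> (m + k) / (\<delta> m * \<delta> k)) powr p" for k
  have b0: "0 \<le> b k" for k by (simp add: b_def)
  define t where "t = (\<lambda>n. cmod (fps_nth (?T f) n) powr p * \<beta> n powr p)"
  have "(\<Sum>L. fps_nth f L * coeff (\<phi> ^ L) k) = coeff (\<phi> ^ l) k / of_real (\<beta> l)" for k
  proof -
    have "(\<lambda>L. fps_nth f L * coeff (\<phi> ^ L) k) =
        (\<lambda>L. if L = l then coeff (\<phi> ^ L) k / of_real (\<beta> L) else 0)"
      by (auto simp: f_nth)
    then show ?thesis using sums_single[of l "\<lambda>L. coeff (\<phi> ^ L) k / of_real (\<beta> L)"]
      by (simp add: sums_iff)
  qed
  then have column: "cmod (\<Sum>L. fps_nth f L * coeff (\<phi> ^ L) k) = cmod (coeff (\<phi> ^ l) k) / \<beta> l" for k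
    using \<beta>_pos[of l] by (simp add: norm_divide)
  have t_shift: "t (m + k) = b k / \<beta> l powr p" for k
  proof -
    let ?w = "\<delta> (m + k) * \<beta> (m + k) / (\<delta> m * \<delta> k)"
    have "t (m + k) = ?w powr p * (cmod (coeff (\<phi> ^ l) k) / \<beta> l) powr p"
      unfolding t_def using subst_op_X_power_weighted_nth[of \<delta>, OF \<delta>_pos] by (simp only: column)
    also have "\<dots> = (?w * cmod (coeff (\<phi> ^ l) k)) powr p / \<beta> l powr p"
      using \<beta>_pos[of l] by (simp add: powr_mult powr_divide)
    also have "?w * cmod (coeff (\<phi> ^ l) k) =
        \<delta> (m + k) * cmod (coeff (\<phi> ^ l) k) * \<beta> (m + k) / (\<delta> m * \<delta> k)"
      by simp
    finally show ?thesis by (simp only: b_def)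
  qed
  have "summable t"
    using bounded f by (simp add: bounded_subst_op_def lp_space_def t_def)
  moreover have "t n = 0" if "n < m" for n
    using that by (simp add: t_def subst_op_X_power_nth)
  ultimately have t: "(\<lambda>k. b k / \<beta> l powr p) sums suminf t"
    using sums_shift_iff[of m t "suminf t"] summable_sums[of t] by (simp add: t_shift)
  then have "(\<lambda>k. b k / \<beta> l powr p * \<beta> l powr p) sums (suminf t * \<beta> l powr p)"
    by (rule sums_mult2)
  then have b: "b sums (suminf t * \<beta> l powr p)"
    using \<beta>_pos[of l] by simp
  have t0: "0 \<le> suminf t"
    using \<open>summable t\<close> by (intro suminf_nonneg) (auto simp: t_def)
  have "(\<Sum>k. ennreal (b k)) = ennreal (suminf t * \<beta> l powr p)"
    using suminf_ennreal_eq[OF b0 b] .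
  then have "ennreal_powr (\<Sum>k. ennreal (b k)) (1 / p) =
      ennreal (suminf t powr (1 / p) * \<beta> l)"
    using p \<beta>_pos[of l] t0 by (simp add: ennreal_powr_def powr_mult powr_powr)
  also have "\<dots> / ennreal (\<beta> l) = ennreal (lp_norm p \<beta> (?T f))"
    using \<beta>_pos[of l] by (simp add: divide_ennreal lp_norm_def t_def)
  also have "\<dots> \<le> ennreal (subst_op_norm p \<beta> \<delta> (fps_X ^ m) \<phi>)"
    using subst_op_norm_upper[OF bounded f] f_norm by (intro ennreal_leI) simp
  finally show ?thesis by (simp add: b_def)
qed

section \<open>Boundedness of the substitution operator\<close>

theorem theorem2p5:
  fixes p :: real and q :: ennreal
    and \<beta> \<delta> :: "nat \<Rightarrow> real"
    and d m0 :: nat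
    and \<alpha> :: "nat \<Rightarrow> real"
    and u :: "complex fps" and \<phi> :: "complex poly"
    and A M :: ennreal
  assumes p: "1 \<le> p" and q: "1 / ennreal p + 1 / q = 1"
    and \<beta>_pos: "\<And>n. 0 < \<beta> n" and \<beta>_0: "\<beta> 0 = 1"
    and \<delta>_pos: "\<And>n. 0 < \<delta> n" and \<delta>_0: "\<delta> 0 = 1"
    and u: "u = fps_X ^ m0"
    and \<phi>: "\<phi> = (\<Sum>m=0..d. monom (complex_of_real (\<alpha> m)) m)"
    and standing:
      "(\<lambda>n. \<beta> (n + 1) / \<beta> n) \<longlonglongrightarrow> 1 \<or> liminf (\<lambda>n. ereal (root n (\<beta> n))) = 1
       \<Longrightarrow> poly \<phi> ` ball 0 1 \<subseteq> ball 0 1"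
    and A: "A = (\<Sum>\<^sub>\<infinity>n\<in>{m0..}.
      ennreal ((\<delta> n * \<beta> n / (\<delta> m0 * \<delta> (n - m0))) powr p) *
      lq_sum_powr p q (\<lambda>L. \<bar>theta d \<alpha> (n - m0) L\<bar> / \<beta> L))"
    and M: "M = (SUP l.
      ennreal_powr
        (\<Sum>\<^sub>\<infinity>n\<in>{m0..}.
          ennreal ((\<delta> n * \<bar>theta d \<alpha> (n - m0) l\<bar> * \<beta> n / (\<delta> m0 * \<delta> (n - m0))) powr p))
        (1 / p) / ennreal (\<beta> l))"
  shows "(A < \<infinity> \<longrightarrow> bounded_subst_op p \<beta> \<delta> u \<phi>) \<and>
    (bounded_subst_op p \<beta> \<delta> u \<phi> \<longrightarrow>
       M < \<infinity> \<and> M \<le> ennreal (subst_op_norm p \<beta> \<delta> u \<phi>))"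
  proof -
  have coeff: "\<bar>theta d \<alpha> k L\<bar> = cmod (coeff (\<phi> ^ L) k)" for L k
    by (simp add: \<phi> coeff_power_eq_theta)
  show ?thesis
  proof (intro conjI impI)
    assume "A < \<infinity>"
    then show "bounded_subst_op p \<beta> \<delta> u \<phi>"
      unfolding u A infsum_atLeast_ennreal coeff diff_add_inverse
      by (rule bounded_subst_op_if_rows[OF p q \<beta>_pos \<delta>_pos])
  next
    assume bounded: "bounded_subst_op p \<beta> \<delta> u \<phi>"
    show le: "M \<le> ennreal (subst_op_norm p \<beta> \<delta> u \<phi>)"
      unfolding u M infsum_atLeast_ennreal coeff diff_add_inverse
      by (intro SUP_least subst_op_norm_ge_column[OF p \<beta>_pos \<delta>_pos bounded[unfolded u]])
    show "M < \<infinity>"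
      by (rule le_less_trans[OF le]) simp
  qed
qed

end
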